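(* Let $\mathcal{A}$ be a unital $C^*$-algebra, let $a,b\in\mathcal{A}$ and suppose that there exist projections $p,q,p',q',\tilde p,\tilde q$ in $\mathcal{A}$ such that $(1-q)a(1-p)=a$, $(1-q')b(1-p')=b$, $(1-\tilde q)ba(1-\tilde p)=ba$, and $a$, $b$, $ba$ are invertible up to $(p,q)$, $(p',q')$ and $(\tilde p,\tilde q)$, respectively. If $p\sim q$ and $p'\sim q'$, then $\tilde p\sim\tilde q$. Moreover, $p\le\tilde p$, $q'\le\tilde q$, $\tilde p-p\preceq p'$ and $\tilde q-q'\preceq q$.
   Context: For projections $p,q\in\mathcal{A}$: $p\sim q$ means there is $v\in\mathcal{A}$ with $vv^*=p$, $v^*v=q$; $p\preceq q$ means there is a projection $r\in\mathcal{A}$ with $r\le q$ and $p\sim r$. For $a\in\mathcal{A}$ and projections $p,q\in\mathcal{A}$, $a$ is invertible up to the pair $(p,q)$ if, with $a'=(1-q)a(1-p)$, there is $c\in\mathcal{A}$ with $c=(1-p)c(1-q)$, $a'c=1-q$, $ca'=1-p$. *)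

theory Defs
  imports Complex_Main
begin

text \<open>
  Unital C*-algebras over the complex numbers.  The class is built on
  \<^class>\<open>real_normed_algebra\<close> and \<^class>\<open>monoid_mult\<close> rather than on
  \<^class>\<open>real_normed_algebra_1\<close>, because the latter forces \<open>0 \<noteq> 1\<close> and would
  exclude the zero algebra.  The law \<open>1 *\<^sub>C x = x\<close> follows from \<open>scaleR_eq_scaleC\<close>.
\<close>

class unital_cstar_algebra = real_normed_algebra + banach + monoid_mult +
  fixes scaleC :: "complex \<Rightarrow> 'a \<Rightarrow> 'a"  (infixr \<open>*\<^sub>C\<close> 75)
    and cstar :: "'a \<Rightarrow> 'a"  (\<open>_\<^sup>\<star>\<close> [1000] 999)
  assumes scaleC_add_right: "c *\<^sub>C (x + y) = c *\<^sub>C x + c *\<^sub>C y"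
    and scaleC_add_left: "(c + d) *\<^sub>C x = c *\<^sub>C x + d *\<^sub>C x"
    and scaleC_scaleC: "c *\<^sub>C (d *\<^sub>C x) = (c * d) *\<^sub>C x"
    and scaleR_eq_scaleC: "r *\<^sub>R x = complex_of_real r *\<^sub>C x"
    and mult_scaleC_left: "(c *\<^sub>C x) * y = c *\<^sub>C (x * y)"
    and mult_scaleC_right: "x * (c *\<^sub>C y) = c *\<^sub>C (x * y)"
    and norm_scaleC: "norm (c *\<^sub>C x) = cmod c * norm x"
    and cstar_cstar: "(x\<^sup>\<star>)\<^sup>\<star> = x"
    and cstar_add: "(x + y)\<^sup>\<star> = x\<^sup>\<star> + y\<^sup>\<star>"
    and cstar_scaleC: "(c *\<^sub>C x)\<^sup>\<star> = cnj c *\<^sub>C x\<^sup>\<star>"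
    and cstar_mult: "(x * y)\<^sup>\<star> = y\<^sup>\<star> * x\<^sup>\<star>"
    and norm_cstar_mult_self: "norm (x\<^sup>\<star> * x) = (norm x)\<^sup>2"

definition is_projection :: "'a::unital_cstar_algebra \<Rightarrow> bool"
  where "is_projection p \<longleftrightarrow> p\<^sup>\<star> = p \<and> p * p = p"

definition cstar_spectrum :: "'a::unital_cstar_algebra \<Rightarrow> complex set"
  where "cstar_spectrum a =
    {z. \<not> (\<exists>y. (a - z *\<^sub>C 1) * y = 1 \<and> y * (a - z *\<^sub>C 1) = 1)}"

definition cstar_positive :: "'a::unital_cstar_algebra \<Rightarrow> bool"
  where "cstar_positive a \<longleftrightarrow>
    a\<^sup>\<star> = a \<and> cstar_spectrum a \<subseteq> complex_of_real ` {0..}"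

text \<open>The order of the C*-algebra on self-adjoint elements, in particular on projections.\<close>

definition cstar_le :: "'a::unital_cstar_algebra \<Rightarrow> 'a \<Rightarrow> bool"  (infix \<open>\<le>\<^sub>A\<close> 50)
  where "a \<le>\<^sub>A b \<longleftrightarrow> a\<^sup>\<star> = a \<and> b\<^sup>\<star> = b \<and> cstar_positive (b - a)"

text \<open>
  Equivalence and subequivalence are relations between projections; both
  imply that their arguments are projections.
\<close>

definition proj_equiv :: "'a::unital_cstar_algebra \<Rightarrow> 'a \<Rightarrow> bool"  (infix \<open>\<sim>\<^sub>A\<close> 50)
  where "p \<sim>\<^sub>A q \<longleftrightarrow>
    is_projection p \<and> is_projection q \<and> (\<exists>v. v * v\<^sup>\<star> = p \<and> v\<^sup>\<star> * v = q)"

definition proj_subequiv :: "'a::unital_cstar_algebra \<Rightarrow> 'a \<Rightarrow> bool"  (infix \<open>\<preceq>\<^sub>A\<close> 50)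
  where "p \<preceq>\<^sub>A q \<longleftrightarrow>
    is_projection p \<and> is_projection q \<and> (\<exists>r. is_projection r \<and> r \<le>\<^sub>A q \<and> p \<sim>\<^sub>A r)"

definition invertible_up_to ::
    "'a::unital_cstar_algebra \<Rightarrow> 'a \<Rightarrow> 'a \<Rightarrow> bool"
  where "invertible_up_to a p q \<longleftrightarrow>
    (let a' = (1 - q) * a * (1 - p) in
      \<exists>c. c = (1 - p) * c * (1 - q) \<and> a' * c = 1 - q \<and> c * a' = 1 - p)"

end

theory Submission
  imports Defs "HOL-Computational_Algebra.Formal_Power_Series"
begin

text \<open>
  The kernel of \<open>ba\<close> is the kernel of \<open>a\<close> plus a part that \<open>a\<close> maps isomorphically onto
  \<open>s = ran a \<inter> ker b\<close>, so \<open>pt - p \<sim> s \<le> p'\<close>; dually \<open>qt - q' \<sim> t \<le> q\<close> with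
  \<open>t = ran b\<^sup>\<star> \<inter> ker a\<^sup>\<star>\<close>. Since \<open>ba\<close> has closed range, \<open>qp'\<close> is invertible from \<open>p' - s\<close>
  to \<open>q - t\<close>, so these are equivalent as well. Transporting \<open>q = (q - t) + t\<close> to \<open>p\<close> and
  \<open>p' = (p' - s) + s\<close> to \<open>q'\<close> then decomposes \<open>pt\<close> and \<open>qt\<close> into pairwise equivalent parts.

  Each equivalence is the polar decomposition of an element \<open>w\<close> that is left invertible in a
  corner, which rests on the positivity of \<open>x\<^sup>\<star> * x\<close>.
\<close>

section \<open>Scalars, involution, norm estimates and the Neumann series\<close>

lemma scaleC_zero_right [simp]: "c *\<^sub>C (0::'a::unital_cstar_algebra) = 0"
  using scaleC_add_right[of c 0 "0::'a"] by simp

lemma scaleC_zero_left [simp]: "0 *\<^sub>C (x::'a::unital_cstar_algebra) = 0"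
  using scaleC_add_left[of 0 0 x] by simp

lemma scaleC_one [simp]: "1 *\<^sub>C (x::'a::unital_cstar_algebra) = x"
  using scaleR_eq_scaleC[of 1 x] by simp

lemma scaleC_minus_right: "c *\<^sub>C (- (x::'a::unital_cstar_algebra)) = - (c *\<^sub>C x)"
  using scaleC_add_right[of c x "- x"] by (simp add: add_eq_0_iff)

lemma scaleC_minus_left: "(- c) *\<^sub>C (x::'a::unital_cstar_algebra) = - (c *\<^sub>C x)"
  using scaleC_add_left[of c "- c" x] by (simp add: add_eq_0_iff)

lemma scaleC_diff_right: "c *\<^sub>C (x - (y::'a::unital_cstar_algebra)) = c *\<^sub>C x - c *\<^sub>C y"
  using scaleC_add_right[of c x "- y"] by (simp add: scaleC_minus_right)

lemma scaleC_diff_left: "(c - d) *\<^sub>C (x::'a::unital_cstar_algebra) = c *\<^sub>C x - d *\<^sub>C x"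
  using scaleC_add_left[of c "- d" x] by (simp add: scaleC_minus_left)

lemma cstar_scaleR: "(r *\<^sub>R (x::'a::unital_cstar_algebra))\<^sup>\<star> = r *\<^sub>R x\<^sup>\<star>"
  by (simp add: scaleR_eq_scaleC cstar_scaleC)

lemma cstar_zero [simp]: "(0::'a::unital_cstar_algebra)\<^sup>\<star> = 0"
  using cstar_scaleR[of 0 "0::'a"] by simp

lemma cstar_one [simp]: "(1::'a::unital_cstar_algebra)\<^sup>\<star> = 1"
  using cstar_mult[of "1\<^sup>\<star>" "1::'a"] by (simp add: cstar_cstar)

lemma cstar_minus: "(- (x::'a::unital_cstar_algebra))\<^sup>\<star> = - x\<^sup>\<star>"
  using cstar_scaleR[of "-1" x] by simp

lemma cstar_diff: "(x - (y::'a::unital_cstar_algebra))\<^sup>\<star> = x\<^sup>\<star> - y\<^sup>\<star>"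
  using cstar_add[of x "- y"] by (simp add: cstar_minus)

lemmas cstar_simps = cstar_cstar cstar_add cstar_diff cstar_minus cstar_mult cstar_scaleR

text \<open>The C*-identity and submultiplicativity give one inequality; applied to
  \<open>x\<^sup>\<star>\<close> it gives the other.\<close>

lemma norm_cstar [simp]: "norm ((x::'a::unital_cstar_algebra)\<^sup>\<star>) = norm x"
proof -
  have le: "norm y \<le> norm (y\<^sup>\<star>)" for y :: 'a
  proof (cases "y = 0")
    case False
    have "norm y * norm y \<le> norm (y\<^sup>\<star>) * norm y"
      using norm_mult_ineq[of "y\<^sup>\<star>" y] by (simp add: norm_cstar_mult_self power2_eq_square)
    with False show ?thesis by simp
  qed simp
  show ?thesis using le[of x] le[of "x\<^sup>\<star>"] by (simp add: cstar_cstar)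
qed

lemma bounded_linear_cstar: "bounded_linear (cstar :: 'a::unital_cstar_algebra \<Rightarrow> 'a)"
  by (rule bounded_linear_intro[where K = 1]) (simp_all add: cstar_add cstar_scaleR)

lemma cstar_mult_self_eq_0_iff: "(x::'a::unital_cstar_algebra)\<^sup>\<star> * x = 0 \<longleftrightarrow> x = 0"
  using norm_cstar_mult_self[of x] by auto

lemma norm_selfadjoint_square:
  "(x::'a::unital_cstar_algebra)\<^sup>\<star> = x \<Longrightarrow> norm (x * x) = (norm x)\<^sup>2"
  using norm_cstar_mult_self[of x] by simp

lemma norm_projection_le_1:
  assumes "is_projection (p::'a::unital_cstar_algebra)"
  shows "norm p \<le> 1"
proof -
  have "norm p = norm p * norm p"
    using assms norm_selfadjoint_square[of p] by (simp add: is_projection_def power2_eq_square)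
  then show ?thesis by (cases "norm p = 0") auto
qed

lemma is_projection_one: "is_projection (1::'a::unital_cstar_algebra)"
  by (simp add: is_projection_def)

lemmas norm_one_le = norm_projection_le_1[OF is_projection_one]

lemma norm_power_le_power_norm: "norm ((x::'a::unital_cstar_algebra) ^ n) \<le> norm x ^ n"
proof (induction n)
  case 0 show ?case using norm_one_le by simp
next
  case (Suc n)
  have "norm (x ^ Suc n) \<le> norm x * norm (x ^ n)" by (simp add: norm_mult_ineq)
  also have "\<dots> \<le> norm x * norm x ^ n" using Suc by (simp add: mult_left_mono)
  finally show ?case by simp
qed

lemma cstar_power: "((x::'a::unital_cstar_algebra) ^ n)\<^sup>\<star> = (x\<^sup>\<star>) ^ n"
  by (induction n) (simp_all add: cstar_mult power_commutes)

lemma commutes_power: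
  fixes x d :: "'a::unital_cstar_algebra"
  assumes "x * d = d * x" shows "x * d ^ n = d ^ n * x"
proof (induction n)
  case (Suc n)
  have "x * d ^ Suc n = d * (x * d ^ n)" using assms by (metis mult.assoc power_Suc)
  then show ?case using Suc by (simp add: mult.assoc)
qed simp

text \<open>Neumann series: the sum of the powers of \<open>d\<close> is the inverse.\<close>

lemma one_minus_invertible:
  fixes d :: "'a::unital_cstar_algebra"
  assumes "norm d < 1"
  shows "\<exists>n. n * (1 - d) = 1 \<and> (1 - d) * n = 1"
proof -
  have s: "summable (\<lambda>k. d ^ k)"
    by (rule summable_comparison_test'[where g = "\<lambda>k. norm d ^ k" and N = 0])
      (use assms norm_power_le_power_norm in \<open>auto intro: summable_geometric\<close>)
  define n where "n = (\<Sum>k. d ^ k)"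
  have "n = d ^ 0 + (\<Sum>k. d ^ Suc k)"
    unfolding n_def using suminf_split_head[OF s] by simp
  moreover have "(\<Sum>k. d ^ Suc k) = d * n"
    unfolding n_def using suminf_mult[OF s, of d] by simp
  moreover have "(\<Sum>k. d ^ Suc k) = n * d"
    unfolding n_def using suminf_mult2[OF s, of d] by (simp add: power_commutes)
  ultimately have "n = 1 + d * n" "n = 1 + n * d" by simp_all
  then have "n * (1 - d) = 1 \<and> (1 - d) * n = 1"
    by (simp add: algebra_simps)
  then show ?thesis by blast
qed

subsection \<open>Square roots by the binomial series\<close>

text \<open>The Taylor coefficients of \<open>sqrt (1 - x)\<close> at 0.\<close>

definition sqrt_coeff :: "nat \<Rightarrow> real"
  where "sqrt_coeff k = (-1) ^ k * ((1/2) gchoose k)"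

lemma sqrt_coeff_0 [simp]: "sqrt_coeff 0 = 1"
  by (simp add: sqrt_coeff_def)

lemma sqrt_coeff_Suc: "sqrt_coeff (Suc k) = sqrt_coeff k * ((real k - 1/2) / (real k + 1))"
proof -
  have "((1/2) gchoose Suc k) = ((1/2) gchoose k) * ((1/2 - real k) / (real k + 1))"
    using gbinomial_mult_1[of "1/2::real" k] by (simp add: field_simps)
  then have "sqrt_coeff (Suc k) = (-1) ^ k * ((1/2) gchoose k) * (- ((1/2 - real k) / (real k + 1)))"
    by (simp add: sqrt_coeff_def)
  then show ?thesis by (simp only: sqrt_coeff_def minus_divide_left minus_diff_eq)
qed

lemma sqrt_coeff_Suc_nonpos: "sqrt_coeff (Suc k) \<le> 0"
proof (induction k)
  case 0 show ?case by (simp add: sqrt_coeff_Suc)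
next
  case (Suc k)
  show ?case by (subst sqrt_coeff_Suc) (rule mult_nonpos_nonneg[OF Suc], simp)
qed

text \<open>The partial sums have a closed form: a negative multiple of the next coefficient, which
  is nonpositive. This controls the series at the endpoint 1 of its disc of convergence.\<close>

lemma sum_sqrt_coeff_nonneg: "0 \<le> (\<Sum>k\<le>n. sqrt_coeff k)"
proof -
  have eq: "(\<Sum>k\<le>n. sqrt_coeff k) = (-2 * (real n + 1)) * sqrt_coeff (Suc n)"
  proof (induction n)
    case 0 show ?case by (simp add: sqrt_coeff_Suc)
  next
    case (Suc n)
    show ?case unfolding sum.atMost_Suc Suc sqrt_coeff_Suc[of "Suc n"]
      by (simp add: field_simps)
  qed
  show ?thesis unfolding eq using sqrt_coeff_Suc_nonpos[of n] by (intro mult_nonpos_nonpos) auto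
qed

text \<open>All coefficients after the leading 1 are nonpositive, so their absolute values sum to 1
  minus a partial sum of the series.\<close>

lemma sum_abs_sqrt_coeff_le: "(\<Sum>k<n. \<bar>sqrt_coeff (Suc k)\<bar>) \<le> 1"
proof -
  have "(\<Sum>k<n. \<bar>sqrt_coeff (Suc k)\<bar>) = - (\<Sum>k<n. sqrt_coeff (Suc k))"
    using sqrt_coeff_Suc_nonpos by (simp add: sum_negf[symmetric] abs_of_nonpos)
  also have "\<dots> = 1 - (\<Sum>k\<le>n. sqrt_coeff k)"
    by (simp add: sum.atMost_shift)
  finally show ?thesis using sum_sqrt_coeff_nonneg[of n] by simp
qed

lemma summable_abs_sqrt_coeff: "summable (\<lambda>k. \<bar>sqrt_coeff (Suc k)\<bar>)"
  by (rule summableI_nonneg_bounded[where x = 1]) (use sum_abs_sqrt_coeff_le in auto)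

text \<open>The square of the series is \<open>1 - x\<close>: Vandermonde's identity turns the
  convolution into \<open>(-1) ^ k\<close> times the binomial coefficient
  \<open>1 choose k\<close>.\<close>

lemma sqrt_coeff_convolution:
  "(\<Sum>i\<le>k. sqrt_coeff i * sqrt_coeff (k - i)) = (if k = 0 then 1 else if k = 1 then - 1 else 0)"
proof -
  have "(\<Sum>i\<le>k. sqrt_coeff i * sqrt_coeff (k - i))
      = (\<Sum>i\<le>k. (-1) ^ k * (((1/2) gchoose i) * ((1/2) gchoose (k - i))))"
  proof (rule sum.cong[OF refl])
    fix i assume "i \<in> {..k}"
    then have "(-1::real) ^ k = (-1) ^ i * (-1) ^ (k - i)"
      by (simp flip: power_add)
    then show "sqrt_coeff i * sqrt_coeff (k - i) =
        (-1) ^ k * (((1/2) gchoose i) * ((1/2) gchoose (k - i)))"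
      by (simp add: sqrt_coeff_def)
  qed
  also have "\<dots> = (-1) ^ k * ((1::real) gchoose k)"
    using gbinomial_Vandermonde[of "1/2::real" "1/2" k] by (simp add: atLeast0AtMost flip: sum_distrib_left)
  also have "(1::real) gchoose k = of_nat (1 choose k)"
    by (simp add: binomial_gbinomial)
  also have "(-1) ^ k * of_nat (1 choose k) = (if k = 0 then 1 else if k = 1 then - 1 else (0::real))"
    by (cases k) auto
  finally show ?thesis .
qed

text \<open>The binomial series converges absolutely even when \<open>norm d = 1\<close>. The bound
  on \<open>1 - y\<close> makes \<open>y\<close> positive; \<open>y\<close> commutes with whatever
  commutes with \<open>d\<close> because it is a limit of polynomials in \<open>d\<close>.\<close>

lemma sqrt_one_minus:
  fixes d :: "'a::unital_cstar_algebra"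
  assumes sa: "d\<^sup>\<star> = d" and le: "norm d \<le> 1"
  shows "\<exists>y. y\<^sup>\<star> = y \<and> y * y = 1 - d \<and> norm (1 - y) \<le> 1 \<and> (\<forall>x. x * d = d * x \<longrightarrow> x * y = y * x)"
proof -
  define f where "f k = sqrt_coeff k *\<^sub>R d ^ k" for k
  have nle: "norm (f k) \<le> \<bar>sqrt_coeff k\<bar>" for k
  proof -
    have "norm (d ^ k) \<le> 1"
      using norm_power_le_power_norm[of d k] power_le_one[of "norm d" k] le by simp
    then show ?thesis by (simp add: f_def mult_left_le)
  qed
  have s: "summable (\<lambda>k. norm (f k))"
    unfolding summable_Suc_iff[symmetric, of "\<lambda>k. norm (f k)"]
    by (rule summable_comparison_test'[OF summable_abs_sqrt_coeff, of 0]) (simp add: nle)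
  then have sf: "summable f" by (rule summable_norm_cancel)
  define y where "y = suminf f"
  have "y\<^sup>\<star> = (\<Sum>k. (f k)\<^sup>\<star>)"
    unfolding y_def by (rule bounded_linear.suminf[OF bounded_linear_cstar sf])
  moreover have "(f k)\<^sup>\<star> = f k" for k
    by (simp add: f_def cstar_scaleR cstar_power sa)
  ultimately have 1: "y\<^sup>\<star> = y" by (simp add: y_def)
  have "(\<lambda>k. \<Sum>i\<le>k. f i * f (k - i)) sums (y * y)"
    unfolding y_def by (rule Cauchy_product_sums[OF s s])
  moreover have "(\<Sum>i\<le>k. f i * f (k - i)) = (if k = 0 then 1 else if k = 1 then - d else 0)" for k
  proof -
    have "(\<Sum>i\<le>k. f i * f (k - i)) = (\<Sum>i\<le>k. (sqrt_coeff i * sqrt_coeff (k - i)) *\<^sub>R d ^ k)"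
      by (rule sum.cong[OF refl]) (simp add: f_def flip: power_add)
    also have "\<dots> = (\<Sum>i\<le>k. sqrt_coeff i * sqrt_coeff (k - i)) *\<^sub>R d ^ k"
      by (simp add: scaleR_sum_left)
    finally show ?thesis by (simp add: sqrt_coeff_convolution)
  qed
  ultimately have "(\<lambda>k. if k = 0 then 1 else if k = 1 then - d else 0) sums (y * y)" by simp
  moreover have "(\<lambda>k. if k = 0 then 1 else if k = 1 then - d else 0) sums
      (\<Sum>k\<in>{0,1::nat}. if k = 0 then 1 else if k = 1 then - d else 0)"
    by (rule sums_finite) auto
  ultimately have 2: "y * y = 1 - d" using sums_unique2 by fastforce
  \<comment> \<open>Splitting off the constant term 1 leaves a tail dominated by the coefficient
    sum, which is at most 1.\<close>
  have "suminf f = f 0 + (\<Sum>k. f (Suc k))" using suminf_split_head[OF sf] by simp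
  then have "1 - y = - (\<Sum>k. f (Suc k))" by (simp add: y_def f_def)
  then have "norm (1 - y) = norm (\<Sum>k. f (Suc k))" by simp
  also have "\<dots> \<le> (\<Sum>k. norm (f (Suc k)))"
    by (rule summable_norm) (use s summable_Suc_iff[of "\<lambda>k. norm (f k)"] in simp)
  also have "\<dots> \<le> (\<Sum>k. \<bar>sqrt_coeff (Suc k)\<bar>)"
    by (rule suminf_le[OF nle _ summable_abs_sqrt_coeff])
      (use s summable_Suc_iff[of "\<lambda>k. norm (f k)"] in simp)
  also have "\<dots> \<le> 1"
    by (rule suminf_le_const[OF summable_abs_sqrt_coeff sum_abs_sqrt_coeff_le])
  finally have 3: "norm (1 - y) \<le> 1" .
  have 4: "x * y = y * x" if "x * d = d * x" for x
    unfolding y_def suminf_mult[OF sf, symmetric] suminf_mult2[OF sf]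
    using commutes_power[OF that] by (simp add: f_def)
  show ?thesis using 1 2 3 4 by blast
qed

subsection \<open>Positivity\<close>

text \<open>Equivalent to \<^const>\<open>cstar_positive\<close>, but visibly a convex cone and closed under
  the square roots above, so that no spectral theory is needed.\<close>

definition norm_positive :: "'a::unital_cstar_algebra \<Rightarrow> bool"
  where "norm_positive a \<longleftrightarrow> a\<^sup>\<star> = a \<and> (\<exists>s\<ge>0. norm (s *\<^sub>R 1 - a) \<le> s)"

lemma norm_positive_add:
  assumes "norm_positive a" "norm_positive b"
  shows "norm_positive (a + b)"
proof -
  obtain s t where st: "s \<ge> 0" "norm (s *\<^sub>R 1 - a) \<le> s" "t \<ge> 0" "norm (t *\<^sub>R 1 - b) \<le> t"
    using assms by (auto simp: norm_positive_def)
  have "norm ((s + t) *\<^sub>R 1 - (a + b)) \<le> s + t"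
    using norm_triangle_ineq[of "s *\<^sub>R 1 - a" "t *\<^sub>R 1 - b"] st by (simp add: algebra_simps)
  then show ?thesis
    using assms st unfolding norm_positive_def by (intro conjI exI[of _ "s + t"]) (auto simp: cstar_add)
qed

text \<open>Rescaling: \<open>a\<close> is \<open>s\<close> times \<open>1 - d\<close> with
  \<open>norm d \<le> 1\<close>, so \<open>sqrt s\<close> times the root of \<open>1 - d\<close>
  works.\<close>

lemma norm_positive_sqrt:
  fixes a :: "'a::unital_cstar_algebra"
  assumes "norm_positive a"
  shows "\<exists>y. norm_positive y \<and> y * y = a \<and> (\<forall>x. x * a = a * x \<longrightarrow> x * y = y * x)"
proof -
  obtain s where s: "s \<ge> 0" "norm (s *\<^sub>R 1 - a) \<le> s" and sa: "a\<^sup>\<star> = a"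
    using assms by (auto simp: norm_positive_def)
  show ?thesis
  proof (cases "s = 0")
    case True
    \<comment> \<open>For \<open>s = 0\<close> the norm bound forces \<open>a = 0\<close>.\<close>
    then show ?thesis using s assms by (intro exI[of _ 0]) auto
  next
    case False
    then have pos: "s > 0" using s by simp
    define d where "d = 1 - (1 / s) *\<^sub>R a"
    have d: "d\<^sup>\<star> = d" by (simp add: d_def cstar_simps sa)
    have "d = (1 / s) *\<^sub>R (s *\<^sub>R 1 - a)" using pos by (simp add: d_def scaleR_diff_right)
    then have "norm d \<le> 1" using s pos by (simp add: divide_le_eq)
    then obtain y where y: "y\<^sup>\<star> = y" "y * y = 1 - d" "norm (1 - y) \<le> 1"
      "\<And>x. x * d = d * x \<Longrightarrow> x * y = y * x"
      using sqrt_one_minus[OF d] by blast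
    have "norm (sqrt s *\<^sub>R 1 - sqrt s *\<^sub>R y) \<le> sqrt s"
      using y(3) pos by (simp flip: scaleR_diff_right add: mult_left_le)
    then have "norm_positive (sqrt s *\<^sub>R y)"
      unfolding norm_positive_def using pos y(1)
      by (intro conjI exI[of _ "sqrt s"]) (auto simp: cstar_scaleR)
    moreover have "(sqrt s *\<^sub>R y) * (sqrt s *\<^sub>R y) = a"
      using pos y(2) by (simp add: d_def)
    moreover have "x * (sqrt s *\<^sub>R y) = (sqrt s *\<^sub>R y) * x" if "x * a = a * x" for x
    proof -
      have "x * d = d * x" using that by (simp add: d_def algebra_simps)
      then show ?thesis using y(4)[of x] by simp
    qed
    ultimately show ?thesis by blast
  qed
qed

text \<open>The element \<open>m + \<i>j\<close> is normal, of norm \<open>sqrt L\<close>, and \<open>m\<close> is its real part.\<close>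

lemma norm_square_le_if_sum_squares:
  fixes m j :: "'a::unital_cstar_algebra"
  assumes "m\<^sup>\<star> = m" "j\<^sup>\<star> = j" "m * j = j * m" "m * m + j * j = L *\<^sub>R 1" "L \<ge> 0"
  shows "norm (m * m) \<le> L"
proof -
  define u where "u = m + \<i> *\<^sub>C j"
  have us: "u\<^sup>\<star> = m - \<i> *\<^sub>C j"
    using assms by (simp add: u_def cstar_add cstar_scaleC scaleC_minus_left)
  have "u\<^sup>\<star> * u = L *\<^sub>R 1"
    unfolding us unfolding u_def using assms(3,4)
    by (simp add: algebra_simps mult_scaleC_left mult_scaleC_right scaleC_scaleC
        scaleC_minus_left scaleC_diff_right)
  then have "(norm u)\<^sup>2 = norm (L *\<^sub>R (1::'a))" using norm_cstar_mult_self[of u] by simp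
  also have "\<dots> \<le> L" using norm_one_le[where 'a = 'a] assms(5) mult_left_mono[of "norm (1::'a)" 1 L] by simp
  finally have nu: "(norm u)\<^sup>2 \<le> L" .
  have "2 *\<^sub>R m = u + u\<^sup>\<star>" unfolding us unfolding u_def by (simp add: scaleR_2)
  then have "2 * norm m = norm (u + u\<^sup>\<star>)" by (metis abs_numeral norm_scaleR)
  also have "\<dots> \<le> 2 * norm u" using norm_triangle_ineq[of u "u\<^sup>\<star>"] by simp
  finally have "norm m \<le> norm u" by simp
  then have "(norm m)\<^sup>2 \<le> (norm u)\<^sup>2" by (simp add: power_mono)
  then show ?thesis using nu norm_selfadjoint_square[OF assms(1)] by linarith
qed

text \<open>For large \<open>s\<close> the element \<open>s *\<^sub>R 1 - h * h\<close> is itself a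
  square of a self-adjoint element commuting with \<open>h\<close>. The two squares add up to
  \<open>s *\<^sub>R 1\<close>, so the preceding bound applies.\<close>

lemma norm_positive_square:
  fixes h :: "'a::unital_cstar_algebra"
  assumes sa: "h\<^sup>\<star> = h"
  shows "norm_positive (h * h)"
proof -
  \<comment> \<open>The added 1 keeps \<open>s\<close> positive when \<open>h = 0\<close>.\<close>
  define s where "s = (norm h)\<^sup>2 + 1"
  have s: "s > 0" unfolding s_def by (simp add: add_nonneg_pos)
  define d where "d = (1 / s) *\<^sub>R (h * h)"
  have d: "d\<^sup>\<star> = d" by (simp add: d_def cstar_simps sa)
  have "norm d \<le> 1"
    using s by (simp add: d_def norm_selfadjoint_square[OF sa] divide_le_eq) (simp add: s_def)
  then obtain y where y: "y\<^sup>\<star> = y" "y * y = 1 - d"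
      "\<And>x. x * d = d * x \<Longrightarrow> x * y = y * x"
    using sqrt_one_minus[OF d] by blast
  have "h * d = d * h" by (simp add: d_def mult.assoc)
  then have hy: "h * y = y * h" by (rule y(3))
  have "norm ((sqrt s *\<^sub>R y) * (sqrt s *\<^sub>R y)) \<le> s"
  proof (rule norm_square_le_if_sum_squares[where j = h])
    show "sqrt s *\<^sub>R y * sqrt s *\<^sub>R y + h * h = s *\<^sub>R 1"
      using s y(2) by (simp add: d_def scaleR_diff_right)
  qed (use s sa y(1) hy in \<open>auto simp: cstar_scaleR\<close>)
  then have "norm (s *\<^sub>R 1 - h * h) \<le> s"
    using s y(2) by (simp add: d_def scaleR_diff_right)
  then show ?thesis
    unfolding norm_positive_def using s sa by (intro conjI exI[of _ s]) (auto simp: cstar_mult)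
qed

text \<open>After division by \<open>s + t\<close> the element is \<open>1 - d\<close> with
  \<open>norm d \<le> s / (s + t) < 1\<close>.\<close>

lemma norm_positive_plus_invertible:
  fixes a :: "'a::unital_cstar_algebra"
  assumes "norm_positive a" "t > 0"
  shows "\<exists>n. n * (t *\<^sub>R 1 + a) = 1 \<and> (t *\<^sub>R 1 + a) * n = 1"
proof -
  obtain s where s: "s \<ge> 0" "norm (s *\<^sub>R 1 - a) \<le> s" using assms by (auto simp: norm_positive_def)
  define d where "d = (1 / (s + t)) *\<^sub>R (s *\<^sub>R 1 - a)"
  have "norm d < 1" using s assms(2) by (simp add: d_def)
  then obtain n where n: "n * (1 - d) = 1" "(1 - d) * n = 1" using one_minus_invertible by blast
  have "1 - d = (1 / (s + t)) *\<^sub>R ((s + t) *\<^sub>R 1 - (s *\<^sub>R 1 - a))"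
    using s assms(2) by (simp only: d_def scaleR_diff_right[of "1 / (s+t)"]) simp
  then have e: "1 - d = (1 / (s + t)) *\<^sub>R (t *\<^sub>R 1 + a)" by (simp add: algebra_simps)
  show ?thesis using n unfolding e by (intro exI[of _ "(1 / (s + t)) *\<^sub>R n"]) simp
qed

lemma inverse_commutes:
  fixes x T n :: "'a::monoid_mult"
  assumes "n * T = 1" "T * n = 1" "x * T = T * x"
  shows "x * n = n * x"
  using assms by (metis mult.assoc mult_1_left mult_1_right)

lemma inverse_selfadjoint:
  fixes T n :: "'a::unital_cstar_algebra"
  assumes "n * T = 1" "T * n = 1" "T\<^sup>\<star> = T"
  shows "n\<^sup>\<star> = n"
proof -
  have "n\<^sup>\<star> * T = 1" using arg_cong[OF assms(2), of cstar] by (simp add: cstar_mult assms(3))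
  then show ?thesis using assms by (metis mult.assoc mult_1_left mult_1_right)
qed

text \<open>The norm of \<open>m * m\<close> lies in its spectrum. Otherwise
  \<open>T = M *\<^sub>R 1 - m * m\<close>, being positive and invertible, stays above some
  \<open>e > 0\<close>; then \<open>T - e *\<^sub>R 1\<close> is a square, and the sum-of-squares
  bound improves \<open>norm (m * m) = M\<close> to \<open>M - e\<close>.\<close>

lemma norm_minus_square_not_invertible:
  fixes m :: "'a::unital_cstar_algebra"
  assumes sa: "m\<^sup>\<star> = m" and M: "M = norm (m * m)" "M > 0"
    and inv: "n * (M *\<^sub>R 1 - m * m) = 1" "(M *\<^sub>R 1 - m * m) * n = 1"
  shows False
proof -
  define T where "T = M *\<^sub>R 1 - m * m"
  have Ts: "T\<^sup>\<star> = T" by (simp add: T_def cstar_simps sa)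
  have nT: "n * T = 1" "T * n = 1" using inv by (simp_all add: T_def)
  have "norm_positive T"
    unfolding norm_positive_def using Ts M by (intro conjI exI[of _ M]) (auto simp: T_def)
  then obtain y where y: "y\<^sup>\<star> = y" "y * y = T" "\<And>x. x * T = T * x \<Longrightarrow> x * y = y * x"
    using norm_positive_sqrt unfolding norm_positive_def by metis
  have ns: "n\<^sup>\<star> = n" by (rule inverse_selfadjoint[OF nT Ts])
  note comm_n = inverse_commutes[OF nT]
  have "n \<noteq> 0"
  proof
    assume "n = 0"
    then have "(1::'a) = 0" using nT by simp
    then have "m * m = 0" by (metis mult_1_right mult_zero_right)
    then show False using M by simp
  qed
  \<comment> \<open>Small enough that \<open>1 - e *\<^sub>R n\<close> has a square root and that
    \<open>M - e\<close> is nonnegative.\<close>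
  define e where "e = min M (1 / norm n)"
  have e: "0 < e" "e \<le> M" "e * norm n \<le> 1"
    using M \<open>n \<noteq> 0\<close> by (auto simp: e_def min_def field_simps)
  have "(e *\<^sub>R n)\<^sup>\<star> = e *\<^sub>R n" "norm (e *\<^sub>R n) \<le> 1" using e ns by (auto simp: cstar_scaleR)
  then obtain k where k: "k\<^sup>\<star> = k" "k * k = 1 - e *\<^sub>R n"
      "\<And>x. x * (e *\<^sub>R n) = (e *\<^sub>R n) * x \<Longrightarrow> x * k = k * x"
    using sqrt_one_minus by metis
  have comm_k: "x * k = k * x" if "x * T = T * x" for x
    using comm_n[OF that] by (intro k(3)) simp
  have mT: "m * T = T * m" by (simp add: T_def algebra_simps)
  have yT: "y * T = T * y" by (simp add: y(2)[symmetric] mult.assoc)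
  have yk: "y * k = k * y" by (rule comm_k[OF yT])
  \<comment> \<open>The square of \<open>y * k\<close> is \<open>T * (1 - e *\<^sub>R n)\<close>,
    that is \<open>T - e *\<^sub>R 1\<close>.\<close>
  have "norm (m * m) \<le> M - e"
  proof (rule norm_square_le_if_sum_squares[where j = "y * k"])
    show "(y * k)\<^sup>\<star> = y * k" using y(1) k(1) yk by (simp add: cstar_mult)
    show "m * (y * k) = y * k * m"
      using y(3)[OF mT] comm_k[OF mT] by (metis mult.assoc)
    have "(y * k) * (y * k) = (y * y) * (k * k)" using yk by (metis mult.assoc)
    also have "\<dots> = T - e *\<^sub>R 1" using nT by (simp add: y(2) k(2) algebra_simps)
    finally show "m * m + y * k * (y * k) = (M - e) *\<^sub>R 1" by (simp add: T_def algebra_simps)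
  qed (use sa e in auto)
  then show False using M e by simp
qed

text \<open>If \<open>x\<^sup>\<star> * x\<close> is negative, then \<open>x * x\<^sup>\<star>\<close> is positive, as
  \<open>x\<^sup>\<star> * x + x * x\<^sup>\<star>\<close> is a sum of squares; but both have the same spectrum away from 0.\<close>

lemma eq_0_if_cstar_mult_self_negative:
  fixes x m :: "'a::unital_cstar_algebra"
  assumes sa: "m\<^sup>\<star> = m" and neg: "x\<^sup>\<star> * x = - (m * m)"
  shows "x = 0"
proof (rule ccontr)
  assume "x \<noteq> 0"
  define M where "M = norm (m * m)"
  have M: "M > 0" using \<open>x \<noteq> 0\<close> neg cstar_mult_self_eq_0_iff[of x] by (auto simp: M_def)
  \<comment> \<open>Up to this factor and sign, \<open>h\<close> and \<open>k\<close> are the real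
    and imaginary parts of \<open>x\<close>, normalized so that
    \<open>h * h + k * k = x * x\<^sup>\<star> + x\<^sup>\<star> * x\<close>.\<close>
  define r where "r = sqrt (1/2)"
  have r2: "r * r = 1/2" by (simp add: r_def)
  define h where "h = r *\<^sub>R (x + x\<^sup>\<star>)"
  define k where "k = \<i> *\<^sub>C (r *\<^sub>R (x - x\<^sup>\<star>))"
  have h: "h\<^sup>\<star> = h" by (simp add: h_def cstar_simps add.commute)
  have k: "k\<^sup>\<star> = k"
    by (simp add: k_def cstar_simps cstar_scaleC scaleC_minus_left scaleC_diff_right scaleR_diff_right)
  have hh: "h * h = (1/2) *\<^sub>R ((x + x\<^sup>\<star>) * (x + x\<^sup>\<star>))" by (simp add: h_def r2)
  have kk: "k * k = (1/2) *\<^sub>R (- ((x - x\<^sup>\<star>) * (x - x\<^sup>\<star>)))"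
  proof -
    have "k * k = (\<i> * \<i>) *\<^sub>C ((r *\<^sub>R (x - x\<^sup>\<star>)) * (r *\<^sub>R (x - x\<^sup>\<star>)))"
      by (simp only: k_def mult_scaleC_left mult_scaleC_right scaleC_scaleC)
    then show ?thesis by (simp add: r2 scaleC_minus_left)
  qed
  have "h * h + k * k = (1/2) *\<^sub>R (2 *\<^sub>R (x * x\<^sup>\<star> + x\<^sup>\<star> * x))"
    unfolding hh kk scaleR_add_right[symmetric] by (simp add: algebra_simps scaleR_2)
  then have "x * x\<^sup>\<star> = h * h + k * k + m * m" using neg by simp
  then have "norm_positive (x * x\<^sup>\<star>)"
    using sa h k by (simp add: norm_positive_add norm_positive_square)
  then obtain n where n: "n * (M *\<^sub>R 1 + x * x\<^sup>\<star>) = 1" "(M *\<^sub>R 1 + x * x\<^sup>\<star>) * n = 1"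
    using norm_positive_plus_invertible[OF _ M] by blast
  \<comment> \<open>Jacobson's formula, turning an inverse of
    \<open>M *\<^sub>R 1 + x * x\<^sup>\<star>\<close> into one of
    \<open>M *\<^sub>R 1 + x\<^sup>\<star> * x\<close>.\<close>
  define l where "l = (1 / M) *\<^sub>R (1 - x\<^sup>\<star> * n * x)"
  have eq: "M *\<^sub>R 1 - m * m = M *\<^sub>R 1 + x\<^sup>\<star> * x" using neg by simp
  have "(M *\<^sub>R 1 + x\<^sup>\<star> * x) * (x\<^sup>\<star> * n * x) = x\<^sup>\<star> * ((M *\<^sub>R 1 + x * x\<^sup>\<star>) * n) * x"
    by (simp add: algebra_simps)
  then have "(M *\<^sub>R 1 + x\<^sup>\<star> * x) * (1 - x\<^sup>\<star> * n * x) = M *\<^sub>R 1"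
    using n by (simp add: right_diff_distrib)
  then have 1: "(M *\<^sub>R 1 + x\<^sup>\<star> * x) * l = 1" using M by (simp add: l_def)
  have "(x\<^sup>\<star> * n * x) * (M *\<^sub>R 1 + x\<^sup>\<star> * x) = x\<^sup>\<star> * (n * (M *\<^sub>R 1 + x * x\<^sup>\<star>)) * x"
    by (simp add: algebra_simps)
  then have "(1 - x\<^sup>\<star> * n * x) * (M *\<^sub>R 1 + x\<^sup>\<star> * x) = M *\<^sub>R 1"
    using n by (simp add: left_diff_distrib)
  then have 2: "l * (M *\<^sub>R 1 + x\<^sup>\<star> * x) = 1" using M by (simp add: l_def)
  show False
    by (rule norm_minus_square_not_invertible[OF sa M_def M, of l]) (simp_all only: eq 1 2)
qed

text \<open>With \<open>y\<close> the absolute value of \<open>a\<close>, the element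
  \<open>n = y - a\<close> is twice the negative part of \<open>a\<close>. As
  \<open>n * a = - (n * y)\<close>, \<open>(x * n)\<^sup>\<star> * (x * n)\<close> is minus a
  square, which forces \<open>x * n = 0\<close>, hence \<open>n = 0\<close> and
  \<open>a = y\<close>.\<close>

lemma norm_positive_cstar_mult_self:
  fixes x :: "'a::unital_cstar_algebra"
  shows "norm_positive (x\<^sup>\<star> * x)"
proof -
  define a where "a = x\<^sup>\<star> * x"
  have sa: "a\<^sup>\<star> = a" by (simp add: a_def cstar_simps)
  obtain y where y: "norm_positive y" "y * y = a * a" "\<And>x. x * (a * a) = a * a * x \<Longrightarrow> x * y = y * x"
    using norm_positive_sqrt[OF norm_positive_square[OF sa]] by blast
  have ys: "y\<^sup>\<star> = y" using y(1) by (simp add: norm_positive_def)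
  have ay: "a * y = y * a" by (rule y(3)) (simp add: mult.assoc)
  \<comment> \<open>A root of \<open>y\<close> exhibits \<open>n * y * n\<close> as the square of
    \<open>n * z\<close>.\<close>
  obtain z where z: "norm_positive z" "z * z = y" "\<And>x. x * y = y * x \<Longrightarrow> x * z = z * x"
    using norm_positive_sqrt[OF y(1)] by blast
  have zs: "z\<^sup>\<star> = z" using z(1) by (simp add: norm_positive_def)
  define n where "n = y - a"
  have ns: "n\<^sup>\<star> = n" by (simp add: n_def cstar_simps sa ys)
  have nz: "n * z = z * n" by (rule z(3)) (simp add: n_def algebra_simps ay)
  have na: "n * a = - (n * y)"
    by (simp add: n_def left_diff_distrib y(2) ay)
  have "(x * n)\<^sup>\<star> * (x * n) = n * a * n" by (simp add: cstar_mult ns a_def mult.assoc)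
  also have "\<dots> = - ((n * z) * (n * z))"
    unfolding na using z(2) nz by (metis minus_mult_left mult.assoc)
  finally have "x * n = 0"
    by (rule eq_0_if_cstar_mult_self_negative[rotated]) (simp add: cstar_mult ns zs nz)
  then have "a * n = 0" by (simp add: a_def mult.assoc)
  then have "(a * n)\<^sup>\<star> = 0" by simp
  then have an: "n * a = 0" by (simp add: cstar_mult sa ns)
  then have "n * n = 0" using na by (simp add: n_def right_diff_distrib)
  then have "n = 0" using cstar_mult_self_eq_0_iff[of n] ns by simp
  then show ?thesis using y(1) by (simp add: n_def a_def)
qed

subsection \<open>Projections\<close>

text \<open>Left invertibility makes \<open>w\<^sup>\<star> * w\<close> invertible in the corner of
  \<open>r\<close>, and \<open>g\<close> is its inverse square root there. The factorization
  \<open>v = w * g\<close> lets left annihilators of \<open>w\<close> pass to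
  \<open>v * v\<^sup>\<star>\<close>.\<close>

lemma polar_decomposition:
  fixes w c r :: "'a::unital_cstar_algebra"
  assumes r: "is_projection r" and wr: "w * r = w" and cw: "c * w = r"
  shows "\<exists>v g. v = w * g \<and> v\<^sup>\<star> * v = r \<and> v * v\<^sup>\<star> * w = w"
proof -
  have rs: "r\<^sup>\<star> = r" and rr: "r * r = r" using r by (auto simp: is_projection_def)
  have rw: "r * w\<^sup>\<star> = w\<^sup>\<star>" using arg_cong[OF wr, of cstar] by (simp add: cstar_mult rs)
  have wc: "w\<^sup>\<star> * c\<^sup>\<star> = r" using arg_cong[OF cw, of cstar] by (simp add: cstar_mult rs)
  define C where "C = (norm c)\<^sup>2 + 1"
  have C: "C > 0" unfolding C_def by (simp add: add_nonneg_pos)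
  define k where "k = (1 / C) *\<^sub>R (c\<^sup>\<star> * c)"
  have ks: "k\<^sup>\<star> = k" by (simp add: k_def cstar_simps)
  have "norm k \<le> 1"
    using C by (simp add: k_def norm_cstar_mult_self divide_le_eq) (simp add: C_def)
  then obtain y where y: "y\<^sup>\<star> = y" "y * y = 1 - k"
    using sqrt_one_minus[OF ks] by blast
  \<comment> \<open>Lower bound: \<open>c\<^sup>\<star> * c \<le> C\<close> yields
    \<open>w\<^sup>\<star> * w \<ge> r / C\<close>, with the difference displayed as
    \<open>(y * w)\<^sup>\<star> * (y * w)\<close>.\<close>
  have "(y * w)\<^sup>\<star> * (y * w) = w\<^sup>\<star> * (y * y) * w" by (simp add: cstar_mult y(1) mult.assoc)
  also have "\<dots> = w\<^sup>\<star> * w - (1 / C) *\<^sub>R ((w\<^sup>\<star> * c\<^sup>\<star>) * (c * w))"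
    by (simp add: y(2) k_def algebra_simps)
  also have "\<dots> = w\<^sup>\<star> * w - (1 / C) *\<^sub>R r" by (simp add: wc cw rr)
  finally have xx: "(y * w)\<^sup>\<star> * (y * w) = w\<^sup>\<star> * w - (1 / C) *\<^sub>R r" .
  obtain S where S: "S \<ge> 0" "norm (S *\<^sub>R 1 - (w\<^sup>\<star> * w - (1 / C) *\<^sub>R r)) \<le> S"
    using norm_positive_cstar_mult_self[of "y * w"] unfolding xx norm_positive_def by blast
  \<comment> \<open>With this scale \<open>T *\<^sub>R d\<close> is the compression to
    \<open>r\<close> of an element of norm at most \<open>S < T\<close>, so
    \<open>norm d < 1\<close>.\<close>
  define T where "T = S + 1 / C"
  have T: "T > 0" "S < T" using S C by (auto simp: T_def add_nonneg_pos)
  define d where "d = r - (1 / T) *\<^sub>R (w\<^sup>\<star> * w)"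
  have ds: "d\<^sup>\<star> = d" by (simp add: d_def cstar_simps rs)
  have rd: "r * d = d" by (simp add: d_def right_diff_distrib rr rw flip: mult.assoc)
  have dr: "d * r = d" by (simp add: d_def left_diff_distrib rr wr mult.assoc)
  define E where "E = S *\<^sub>R 1 - (w\<^sup>\<star> * w - (1 / C) *\<^sub>R r)"
  have rwwr: "r * (w\<^sup>\<star> * w) * r = w\<^sup>\<star> * w" by (metis mult.assoc rw wr)
  have "r * E * r = S *\<^sub>R r - w\<^sup>\<star> * w + (1 / C) *\<^sub>R r"
    using rwwr by (simp add: E_def left_diff_distrib right_diff_distrib distrib_left distrib_right rr)
  also have "\<dots> = T *\<^sub>R d" using T by (simp add: T_def[symmetric] d_def scaleR_diff_right)
      (simp add: T_def algebra_simps)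
  finally have "T *\<^sub>R d = r * E * r" ..
  then have "T * norm d = norm (r * E * r)" using T by (metis abs_of_pos norm_scaleR)
  also have "\<dots> \<le> norm r * norm E * norm r"
    by (meson mult_right_mono norm_ge_zero norm_mult_ineq order_trans)
  also have "\<dots> \<le> norm E"
    using norm_projection_le_1[OF r]
    by (metis mult_left_le mult_left_le_one_le mult_nonneg_nonneg norm_ge_zero order_trans)
  also have "\<dots> < T" using S T by (simp add: E_def)
  finally have nd: "norm d < 1" using T by simp
  obtain n where n: "n * (1 - d) = 1" "(1 - d) * n = 1" using one_minus_invertible[OF nd] by blast
  obtain z where z: "z\<^sup>\<star> = z" "z * z = 1 - d" "\<And>x. x * d = d * x \<Longrightarrow> x * z = z * x"
    using sqrt_one_minus[OF ds] nd by (meson less_imp_le)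
  have ns: "n\<^sup>\<star> = n" by (rule inverse_selfadjoint[OF n]) (simp add: cstar_diff ds)
  have zD: "z * (1 - d) = (1 - d) * z" by (simp add: z(2)[symmetric] mult.assoc)
  have zn: "z * n = n * z" by (rule inverse_commutes[OF n zD])
  have rz: "r * z = z * r" by (rule z(3)) (simp add: rd dr)
  have rn: "r * n = n * r" by (rule inverse_commutes[OF n]) (simp add: algebra_simps rd dr)
  \<comment> \<open>The inverse of \<open>z\<close>, hence the inverse square root of
    \<open>1 - d\<close>.\<close>
  define g where "g = z * n"
  have gs: "g\<^sup>\<star> = g" by (simp add: g_def cstar_mult ns z(1) zn)
  have gD: "g * (1 - d) = z" by (simp add: g_def mult.assoc n)
  have gz: "g * z = 1" by (metis g_def mult.assoc n(1) z(2) zn)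
  have zg: "z * g = 1" by (metis g_def mult.assoc n(2) z(2))
  have rg: "r * g = g * r" by (metis g_def mult.assoc rz rn)
  have ww: "w\<^sup>\<star> * w = T *\<^sub>R ((1 - d) * r)"
    using T by (simp add: left_diff_distrib dr) (simp add: d_def)
  define v where "v = w * ((1 / sqrt T) *\<^sub>R g)"
  have vs: "v\<^sup>\<star> = (1 / sqrt T) *\<^sub>R (g * w\<^sup>\<star>)" by (simp add: v_def cstar_simps gs)
  have "v\<^sup>\<star> * v = (1 / T) *\<^sub>R (g * (w\<^sup>\<star> * w) * g)"
    unfolding vs unfolding v_def using T by (simp add: mult.assoc)
  also have "\<dots> = g * (1 - d) * r * g" using T by (simp add: ww mult.assoc)
  also have "\<dots> = z * g * r" using gD rg by (simp add: mult.assoc)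
  also have "\<dots> = r" by (simp add: zg)
  finally have 1: "v\<^sup>\<star> * v = r" .
  have "v * v\<^sup>\<star> * w = (1 / T) *\<^sub>R (w * g * g * (w\<^sup>\<star> * w))"
    unfolding vs unfolding v_def using T by (simp add: mult.assoc)
  also have "\<dots> = w * g * (g * (1 - d)) * r" using T by (simp add: ww mult.assoc)
  also have "\<dots> = w * (g * z) * r" by (simp add: gD mult.assoc)
  also have "\<dots> = w" by (simp add: gz wr)
  finally have "v * v\<^sup>\<star> * w = w" .
  with 1 show ?thesis unfolding v_def by blast
qed

section \<open>Order and equivalence of projections\<close>

lemma projection_absorb_commute:
  assumes "is_projection p" "is_projection q" "p * q = q"
  shows "q * p = q"
  using assms unfolding is_projection_def by (metis cstar_mult)

lemma projection_orthogonal_commute: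
  assumes "is_projection p" "is_projection q" "p * q = 0"
  shows "q * p = 0"
  using assms unfolding is_projection_def by (metis cstar_mult cstar_zero)

lemma is_projection_diff:
  assumes "is_projection p" "is_projection q" "p * q = q"
  shows "is_projection (p - q)"
  using assms projection_absorb_commute[OF assms]
  by (simp add: is_projection_def cstar_diff algebra_simps)

lemma is_projection_add:
  assumes "is_projection p" "is_projection q" "p * q = 0"
  shows "is_projection (p + q)"
  using assms projection_orthogonal_commute[OF assms]
  by (simp add: is_projection_def cstar_add algebra_simps)

text \<open>Away from 0 and 1 the resolvent is explicit: it acts as a scalar on \<open>f\<close> and
  on \<open>1 - f\<close>.\<close>

lemma cstar_positive_projection:
  fixes f :: "'a::unital_cstar_algebra"
  assumes "is_projection f"
  shows "cstar_positive f"
proof -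
  have ff: "f\<^sup>\<star> = f" "f * f = f" using assms by (auto simp: is_projection_def)
  have "z \<in> complex_of_real ` {0..}" if z: "z \<in> cstar_spectrum f" for z
  proof (rule ccontr)
    assume "z \<notin> complex_of_real ` {0..}"
    then have nz: "z \<noteq> 0" "z \<noteq> 1" by (auto simp: image_iff intro: bexI[of _ 0] bexI[of _ 1])
    define y where "y = (1 / (1 - z)) *\<^sub>C f - (1 / z) *\<^sub>C (1 - f)"
    have fz: "(f - z *\<^sub>C 1) * f = (1 - z) *\<^sub>C f" "f * (f - z *\<^sub>C 1) = (1 - z) *\<^sub>C f"
      by (simp_all add: algebra_simps ff mult_scaleC_left mult_scaleC_right scaleC_diff_left)
    have fz': "(f - z *\<^sub>C 1) * (1 - f) = (- z) *\<^sub>C (1 - f)"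
      "(1 - f) * (f - z *\<^sub>C 1) = (- z) *\<^sub>C (1 - f)"
      by (simp_all add: algebra_simps ff mult_scaleC_left mult_scaleC_right scaleC_minus_left
          scaleC_diff_right)
    have "(f - z *\<^sub>C 1) * y = 1"
      unfolding y_def right_diff_distrib[of "f - z *\<^sub>C 1" "(1 / (1 - z)) *\<^sub>C f"] mult_scaleC_right fz fz'
      using nz by (simp add: scaleC_scaleC scaleC_minus_left scaleC_minus_right)
    moreover have "y * (f - z *\<^sub>C 1) = 1"
      unfolding y_def left_diff_distrib[of "(1 / (1 - z)) *\<^sub>C f"] mult_scaleC_left fz fz'
      using nz by (simp add: scaleC_scaleC scaleC_minus_left scaleC_minus_right)
    ultimately show False using z unfolding cstar_spectrum_def by blast
  qed
  then show ?thesis using ff unfolding cstar_positive_def by blast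
qed

lemma projection_le:
  assumes "is_projection p" "is_projection q" "q * p = p"
  shows "p \<le>\<^sub>A q"
  using assms cstar_positive_projection[OF is_projection_diff[OF assms(2,1,3)]]
  by (simp add: cstar_le_def is_projection_def)

text \<open>The defect \<open>u\<close> satisfies \<open>u\<^sup>\<star> * u = 0\<close>, so it
  vanishes by the C*-identity.\<close>

lemma partial_isometry:
  fixes v :: "'a::unital_cstar_algebra"
  assumes "is_projection (v\<^sup>\<star> * v)"
  shows "v * v\<^sup>\<star> * v = v"
proof -
  have p: "v\<^sup>\<star> * v * (v\<^sup>\<star> * v) = v\<^sup>\<star> * v" using assms by (simp add: is_projection_def)
  define u where "u = v - v * v\<^sup>\<star> * v"
  have "u\<^sup>\<star> * u = 0"
    using p by (simp add: u_def cstar_simps algebra_simps)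
  then show ?thesis by (simp add: cstar_mult_self_eq_0_iff u_def)
qed

lemma proj_equivI:
  fixes v :: "'a::unital_cstar_algebra"
  assumes "is_projection p" "v\<^sup>\<star> * v = p"
  shows "p \<sim>\<^sub>A v * v\<^sup>\<star>"
proof -
  have "v * v\<^sup>\<star> * (v * v\<^sup>\<star>) = v * v\<^sup>\<star>"
    using partial_isometry[of v] assms by (simp flip: mult.assoc)
  then show ?thesis
    using assms unfolding proj_equiv_def is_projection_def
    by (intro conjI exI[of _ "v\<^sup>\<star>"]) (auto simp: cstar_simps)
qed

lemma proj_equivE:
  fixes p q :: "'a::unital_cstar_algebra"
  assumes "p \<sim>\<^sub>A q"
  obtains v where "is_projection p" "is_projection q" "v * v\<^sup>\<star> = p" "v\<^sup>\<star> * v = q"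
    "p * v = v" "v * q = v"
  using assms partial_isometry unfolding proj_equiv_def by (metis mult.assoc)

lemma proj_equiv_sym: "p \<sim>\<^sub>A q \<Longrightarrow> q \<sim>\<^sub>A p"
  unfolding proj_equiv_def by (metis cstar_cstar)

lemma proj_equiv_trans:
  assumes "p \<sim>\<^sub>A q" "q \<sim>\<^sub>A r"
  shows "p \<sim>\<^sub>A r"
proof -
  obtain v where v: "is_projection p" "v * v\<^sup>\<star> = p" "v\<^sup>\<star> * v = q" "v * q = v"
    using assms(1) by (rule proj_equivE)
  obtain w where w: "is_projection r" "w * w\<^sup>\<star> = q" "w\<^sup>\<star> * w = r" "q * w = w"
    using assms(2) by (rule proj_equivE)
  have "(v * w) * (v * w)\<^sup>\<star> = p" using v w by (simp add: cstar_mult) (metis mult.assoc)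
  moreover have "(v * w)\<^sup>\<star> * (v * w) = r" using v w by (simp add: cstar_mult) (metis mult.assoc)
  ultimately show ?thesis using v w unfolding proj_equiv_def by blast
qed

text \<open>The sum of the two partial isometries works, since orthogonality kills all cross
  terms.\<close>

lemma proj_equiv_add:
  assumes "p1 \<sim>\<^sub>A q1" "p2 \<sim>\<^sub>A q2" "p1 * p2 = 0" "q1 * q2 = 0"
  shows "p1 + p2 \<sim>\<^sub>A q1 + q2"
proof -
  obtain v where v: "is_projection p1" "is_projection q1" "v * v\<^sup>\<star> = p1" "v\<^sup>\<star> * v = q1"
    "p1 * v = v" "v * q1 = v"
    using assms(1) by (rule proj_equivE)
  obtain w where w: "is_projection p2" "is_projection q2" "w * w\<^sup>\<star> = p2" "w\<^sup>\<star> * w = q2"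
    "p2 * w = w" "w * q2 = w"
    using assms(2) by (rule proj_equivE)
  have "q2 * w\<^sup>\<star> = w\<^sup>\<star>"
    using arg_cong[OF w(6), of cstar] w(2) by (simp add: cstar_mult is_projection_def)
  then have "v * w\<^sup>\<star> = v * (q1 * q2) * w\<^sup>\<star>" by (metis mult.assoc v(6))
  then have vw: "v * w\<^sup>\<star> = 0" using assms by simp
  have wv: "w * v\<^sup>\<star> = 0" using arg_cong[OF vw, of cstar] by (simp add: cstar_simps)
  have "v\<^sup>\<star> * p1 = v\<^sup>\<star>"
    using arg_cong[OF v(5), of cstar] v(1) by (simp add: cstar_mult is_projection_def)
  then have "v\<^sup>\<star> * w = v\<^sup>\<star> * (p1 * p2) * w" by (metis mult.assoc w(5))
  then have vw': "v\<^sup>\<star> * w = 0" using assms by simp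
  have wv': "w\<^sup>\<star> * v = 0" using arg_cong[OF vw', of cstar] by (simp add: cstar_simps)
  have "(v + w) * (v + w)\<^sup>\<star> = p1 + p2" "(v + w)\<^sup>\<star> * (v + w) = q1 + q2"
    using v w vw wv vw' wv' by (simp_all add: cstar_add algebra_simps)
  then show ?thesis
    using is_projection_add v w assms unfolding proj_equiv_def by metis
qed

text \<open>Conjugation by the partial isometry \<open>v\<close> carries both \<open>x\<close> and
  \<open>q - x\<close> to subprojections of \<open>p\<close>.\<close>

lemma proj_equiv_split:
  assumes "p \<sim>\<^sub>A q" "is_projection x" "q * x = x"
  obtains p1 where "is_projection p1" "p1 \<sim>\<^sub>A x" "p * p1 = p1" "p - p1 \<sim>\<^sub>A q - x"
proof -
  obtain v where v: "is_projection p" "is_projection q" "v * v\<^sup>\<star> = p" "v\<^sup>\<star> * v = q"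
    "p * v = v" "v * q = v"
    using assms(1) by (rule proj_equivE)
  have sub: "y \<sim>\<^sub>A v * y * v\<^sup>\<star>" if y: "is_projection y" "q * y = y" for y
  proof -
    have yy: "y * y = y" "y\<^sup>\<star> = y" using y by (auto simp: is_projection_def)
    have "(v * y)\<^sup>\<star> * (v * y) = y * (q * y)" by (simp add: cstar_mult yy v(4)[symmetric] mult.assoc)
    then have "(v * y)\<^sup>\<star> * (v * y) = y" using y yy by simp
    moreover have "(v * y) * (v * y)\<^sup>\<star> = v * y * v\<^sup>\<star>"
      by (simp add: cstar_mult yy(2)) (metis mult.assoc yy(1))
    ultimately show ?thesis using proj_equivI[OF y(1)] by metis
  qed
  define p1 where "p1 = v * x * v\<^sup>\<star>"
  have 1: "p1 \<sim>\<^sub>A x" using sub[OF assms(2,3)] proj_equiv_sym p1_def by blast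
  have q: "is_projection (q - x)" using v assms is_projection_diff by blast
  have "q * (q - x) = q - x" using v assms by (simp add: right_diff_distrib is_projection_def)
  from sub[OF q this] have "q - x \<sim>\<^sub>A p - p1"
    using v by (simp add: p1_def right_diff_distrib left_diff_distrib)
  then have 2: "p - p1 \<sim>\<^sub>A q - x" by (rule proj_equiv_sym)
  have "p * p1 = p1" using v by (simp add: p1_def flip: mult.assoc)
  with 1 2 show ?thesis using that unfolding proj_equiv_def by blast
qed

subsection \<open>Kernels and cokernels of products\<close>

text \<open>Relations of Moore-Penrose type: \<open>p\<close> projects onto the kernel of
  \<open>a\<close> and \<open>1 - q\<close> onto its range. Taking adjoints exchanges
  \<open>p\<close> and \<open>q\<close>.\<close>

definition inverse_up_to :: "'a::unital_cstar_algebra \<Rightarrow> 'a \<Rightarrow> 'a \<Rightarrow> 'a \<Rightarrow> bool"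
  where "inverse_up_to a c p q \<longleftrightarrow> a * c = 1 - q \<and> c * a = 1 - p \<and> a * p = 0 \<and> q * a = 0"

lemma inverse_up_to_exists:
  assumes p: "is_projection p" and q: "is_projection q"
    and a: "(1 - q) * a * (1 - p) = a" and inv: "invertible_up_to a p q"
  shows "\<exists>c. inverse_up_to a c p q"
proof -
  obtain c where "a * c = 1 - q" "c * a = 1 - p"
    using inv unfolding invertible_up_to_def Let_def a by blast
  moreover have "(1 - p) * p = 0" "q * (1 - q) = 0"
    using p q by (simp_all add: is_projection_def algebra_simps)
  then have "a * p = 0" "q * a = 0" using a by (metis mult.assoc mult_zero_left mult_zero_right)+
  ultimately show ?thesis unfolding inverse_up_to_def by blast
qed

lemma inverse_up_to_cstar:
  assumes "is_projection p" "is_projection q" "inverse_up_to a c p q"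
  shows "inverse_up_to (a\<^sup>\<star>) (c\<^sup>\<star>) q p"
  using assms unfolding inverse_up_to_def is_projection_def
  by (metis cstar_diff cstar_mult cstar_one cstar_zero)

text \<open>Whatever \<open>a\<close> kills is killed by \<open>b * a\<close>.\<close>

lemma kernel_le_kernel_mult:
  assumes "inverse_up_to a c p q" "inverse_up_to (b * a) e pt qt"
  shows "pt * p = p"
proof -
  have "(1 - pt) * p = e * b * (a * p)" using assms(2) unfolding inverse_up_to_def by (metis mult.assoc)
  then show ?thesis using assms(1) by (simp add: inverse_up_to_def left_diff_distrib)
qed

text \<open>Here \<open>s\<close> is the projection onto the intersection of the range of \<open>a\<close> with the kernel of
  \<open>b\<close>. The last claim says that \<open>q\<close> is bounded below on \<open>p' - s\<close>.\<close>

lemma kernel_mult_minus_kernel: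
  fixes a b c d e p q p' q' pt qt :: "'a::unital_cstar_algebra"
  assumes proj: "is_projection p" "is_projection p'" "is_projection pt"
    and a: "inverse_up_to a c p q" and b: "inverse_up_to b d p' q'"
    and ba: "inverse_up_to (b * a) e pt qt"
  obtains s l where "is_projection s" "pt - p \<sim>\<^sub>A s" "p' * s = s" "q * s = 0"
    "l * q * (p' - s) = p' - s"
proof -
  note ptp = kernel_le_kernel_mult[OF a ba]
  have ppt: "p * pt = p" by (rule projection_absorb_commute[OF proj(3,1) ptp])
  have r: "is_projection (pt - p)" by (rule is_projection_diff[OF proj(3,1) ptp])
  have pp: "p * p = p" "pt * pt = pt" using proj by (auto simp: is_projection_def)
  have a': "a * c = 1 - q" "c * a = 1 - p" "a * p = 0" "q * a = 0"
    using a by (auto simp: inverse_up_to_def)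
  have b': "d * b = 1 - p'" "b * p' = 0" using b by (auto simp: inverse_up_to_def)
  have ba': "e * (b * a) = 1 - pt" "b * a * pt = 0" using ba by (auto simp: inverse_up_to_def)
  \<comment> \<open>This is \<open>a\<close> restricted to the part of the kernel of
    \<open>b * a\<close> beyond that of \<open>a\<close>; there \<open>c\<close> is a left
    inverse.\<close>
  define w where "w = a * pt"
  have wr: "w * (pt - p) = w"
    by (simp add: w_def right_diff_distrib mult.assoc pp ptp a')
  have cw: "c * w = pt - p"
  proof -
    have "c * w = c * a * pt" by (simp add: w_def mult.assoc)
    then show ?thesis by (simp add: a' left_diff_distrib ppt)
  qed
  obtain v g where v: "v = w * g" "v\<^sup>\<star> * v = pt - p" "v * v\<^sup>\<star> * w = w"
    using polar_decomposition[OF r wr cw] by blast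
  define s where "s = v * v\<^sup>\<star>"
  have eq: "pt - p \<sim>\<^sub>A s" unfolding s_def by (rule proj_equivI[OF r v(2)])
  then have s: "is_projection s" by (simp add: proj_equiv_def)
  have "(1 - p') * w = d * (b * a * pt)" by (simp add: b'(1)[symmetric] w_def mult.assoc)
  then have "p' * w = w" by (simp add: ba' left_diff_distrib)
  then have ps: "p' * s = s" unfolding s_def v(1) by (simp flip: mult.assoc)
  have "q * w = 0" unfolding w_def by (simp add: a' flip: mult.assoc)
  then have qs: "q * s = 0" unfolding s_def v(1) by (simp flip: mult.assoc)
  have sw: "s * w = w" using v by (simp add: s_def)
  define h where "h = p' - s"
  have bh: "b * h = 0"
  proof -
    have "b * s = b * p' * s" by (simp add: ps mult.assoc)
    then show ?thesis by (simp add: h_def right_diff_distrib b')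
  qed
  have sh: "s * h = h - h"
    using projection_absorb_commute[OF proj(2) s ps] s by (simp add: h_def right_diff_distrib is_projection_def)
  \<comment> \<open>To recover \<open>h\<close> from \<open>q * h\<close>, write
    \<open>h = q * h + a * c * h\<close> and split \<open>c * h\<close> by \<open>pt\<close>. The
    \<open>pt\<close> part is sent by \<open>a\<close> into the range of \<open>s\<close>; the rest
    is \<open>- (e * (b * (q * h)))\<close> because \<open>b * h = 0\<close>. Multiplying by
    \<open>1 - s\<close> removes the first part.\<close>
  have ach: "a * c * h = h - q * h" by (simp add: a' left_diff_distrib)
  have "(1 - pt) * (c * h) = e * (b * (a * c * h))" by (simp add: ba'(1)[symmetric] mult.assoc)
  also have "\<dots> = - (e * (b * (q * h)))" unfolding ach by (simp add: right_diff_distrib bh)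
  finally have "c * h = pt * (c * h) - e * (b * (q * h))" by (simp add: left_diff_distrib algebra_simps)
  then have "a * (c * h) = w * (c * h) - a * (e * (b * (q * h)))"
    unfolding w_def by (metis mult.assoc right_diff_distrib)
  then have "h - q * h = w * (c * h) - a * (e * (b * (q * h)))"
    using ach by (simp add: mult.assoc)
  then have "q * h - a * e * b * q * h = h - w * c * h"
    by (simp add: algebra_simps)
  then have "(1 - s) * (q * h - a * e * b * q * h) = (1 - s) * (h - w * c * h)" by simp
  also have "\<dots> = h"
    by (simp add: left_diff_distrib right_diff_distrib sh) (simp add: sw flip: mult.assoc)
  finally have "(1 - s) * (1 - a * e * b) * q * h = h"
    by (simp add: left_diff_distrib right_diff_distrib mult.assoc)
  then show ?thesis using that[OF s eq ps qs] unfolding h_def by blast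
qed

text \<open>Polar decomposition of \<open>q * p\<close>, which kills \<open>s\<close> and has range
  orthogonal to \<open>t\<close>. The bound from \<open>l\<close> makes it left invertible on
  \<open>p - s\<close>; the one from \<open>k\<close>, read through the adjoint, makes its range all
  of \<open>q - t\<close>.\<close>

lemma proj_equiv_of_lower_bounds:
  fixes p q s t :: "'a::unital_cstar_algebra"
  assumes proj: "is_projection p" "is_projection q" "is_projection s" "is_projection t"
    and s: "p * s = s" "q * s = 0" and t: "q * t = t" "p * t = 0"
    and l: "l * q * (p - s) = p - s" and k: "k * p * (q - t) = q - t"
  shows "p - s \<sim>\<^sub>A q - t"
proof -
  have r: "is_projection (p - s)" by (rule is_projection_diff[OF proj(1,3) s(1)])
  have r': "is_projection (q - t)" by (rule is_projection_diff[OF proj(2,4) t(1)])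
  have tq: "t * q = t" by (rule projection_absorb_commute[OF proj(2,4) t(1)])
  have tp: "t * p = 0" by (rule projection_orthogonal_commute[OF proj(1,4) t(2)])
  define w where "w = q * p"
  have w: "w = q * (p - s)" by (simp add: w_def right_diff_distrib s)
  have wr: "w * (p - s) = w" using r unfolding w is_projection_def by (simp add: mult.assoc)
  have lw: "l * w = p - s" using l by (simp add: w mult.assoc)
  obtain v g where v: "v = w * g" "v\<^sup>\<star> * v = p - s" "v * v\<^sup>\<star> * w = w"
    using polar_decomposition[OF r wr lw] by blast
  define f where "f = v * v\<^sup>\<star>"
  have eq: "p - s \<sim>\<^sub>A f" unfolding f_def by (rule proj_equivI[OF r v(2)])
  then have f: "is_projection f" by (simp add: proj_equiv_def)
  have "q * w = w" using proj(2) by (simp add: w_def is_projection_def flip: mult.assoc)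
  then have "q * f = f" unfolding f_def v(1) by (simp flip: mult.assoc)
  then have fq: "f * q = f" by (rule projection_absorb_commute[OF proj(2) f])
  have "t * w = 0" by (simp add: w_def tq tp flip: mult.assoc)
  then have "t * f = 0" unfolding f_def v(1) by (simp flip: mult.assoc)
  then have ft: "f * t = 0" by (rule projection_orthogonal_commute[OF proj(4) f])
  have "(q - t) * p * k\<^sup>\<star> = q - t"
    using arg_cong[OF k, of cstar] r' proj by (simp add: cstar_mult is_projection_def mult.assoc)
  then have "w * k\<^sup>\<star> = q - t" by (simp add: w_def left_diff_distrib tp)
  moreover have "f * (w * k\<^sup>\<star>) = w * k\<^sup>\<star>" using v(3) by (simp add: f_def flip: mult.assoc)
  ultimately have "f * (q - t) = q - t" by simp
  then have "f = q - t" by (simp add: right_diff_distrib fq ft)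
  with eq show ?thesis by simp
qed

section \<open>Splitting \<open>pt\<close> and \<open>qt\<close> into three equivalent
  pieces\<close>

theorem proposition3p23:
  fixes a b p q p' q' pt qt :: "'a::unital_cstar_algebra"
  assumes "is_projection p" and "is_projection q"
    and "is_projection p'" and "is_projection q'"
    and "is_projection pt" and "is_projection qt"
    and "(1 - q) * a * (1 - p) = a"
    and "(1 - q') * b * (1 - p') = b"
    and "(1 - qt) * (b * a) * (1 - pt) = b * a"
    and "invertible_up_to a p q"
    and "invertible_up_to b p' q'"
    and "invertible_up_to (b * a) pt qt"
  shows "(p \<sim>\<^sub>A q \<and> p' \<sim>\<^sub>A q' \<longrightarrow> pt \<sim>\<^sub>A qt)
    \<and> p \<le>\<^sub>A pt \<and> q' \<le>\<^sub>A qt \<and> pt - p \<preceq>\<^sub>A p' \<and> qt - q' \<preceq>\<^sub>A q"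
proof -
  note proj = assms(1-6)
  obtain c where a: "inverse_up_to a c p q" using inverse_up_to_exists assms by blast
  obtain d where b: "inverse_up_to b d p' q'" using inverse_up_to_exists assms by blast
  obtain e where ba: "inverse_up_to (b * a) e pt qt" using inverse_up_to_exists assms by blast
  \<comment> \<open>Adjoints turn cokernels into kernels, so the claims about \<open>qt\<close> are
    those about kernels for \<open>a\<^sup>\<star> * b\<^sup>\<star>\<close>.\<close>
  note a' = inverse_up_to_cstar[OF proj(1,2) a] and b' = inverse_up_to_cstar[OF proj(3,4) b]
  have ba': "inverse_up_to (a\<^sup>\<star> * b\<^sup>\<star>) (e\<^sup>\<star>) qt pt"
    using inverse_up_to_cstar[OF proj(5,6) ba] by (simp add: cstar_mult)
  have ptp: "pt * p = p" by (rule kernel_le_kernel_mult[OF a ba])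
  have qtq: "qt * q' = q'" by (rule kernel_le_kernel_mult[OF b' ba'])
  obtain s l where s: "is_projection s" "pt - p \<sim>\<^sub>A s" "p' * s = s" "q * s = 0"
    and l: "l * q * (p' - s) = p' - s"
    using kernel_mult_minus_kernel[OF proj(1,3,5) a b ba] .
  obtain t k where t: "is_projection t" "qt - q' \<sim>\<^sub>A t" "q * t = t" "p' * t = 0"
    and k: "k * p' * (q - t) = q - t"
    using kernel_mult_minus_kernel[OF proj(4,2,6) b' a' ba'] .
  have mid: "p' - s \<sim>\<^sub>A q - t"
    by (rule proj_equiv_of_lower_bounds[OF proj(3,2) s(1) t(1) s(3,4) t(3,4) l k])
  have "pt \<sim>\<^sub>A qt" if pq: "p \<sim>\<^sub>A q" "p' \<sim>\<^sub>A q'"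
  proof -
    \<comment> \<open>The pieces are \<open>p - p1\<close>, \<open>p1\<close>, \<open>pt - p\<close>
      on one side and, in matching order, \<open>q' - q1\<close>, \<open>qt - q'\<close>,
      \<open>q1\<close> on the other.\<close>
    obtain p1 where p1: "is_projection p1" "p1 \<sim>\<^sub>A t" "p * p1 = p1" "p - p1 \<sim>\<^sub>A q - t"
      using proj_equiv_split[OF pq(1) t(1,3)] .
    obtain q1 where q1: "is_projection q1" "q1 \<sim>\<^sub>A s" "q' * q1 = q1" "q' - q1 \<sim>\<^sub>A p' - s"
      using proj_equiv_split[OF proj_equiv_sym[OF pq(2)] s(1,3)] .
    have 1: "p1 \<sim>\<^sub>A qt - q'" using p1 t proj_equiv_sym proj_equiv_trans by blast
    have 2: "pt - p \<sim>\<^sub>A q1" using q1 s proj_equiv_sym proj_equiv_trans by blast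
    have 3: "p - p1 \<sim>\<^sub>A q' - q1" using p1 q1 mid proj_equiv_sym proj_equiv_trans by blast
    have pp: "p * pt = p" "p1 * p = p1" "p1 * p1 = p1" "p * p = p"
      and qq: "q' * qt = q'" "q1 * q' = q1" "q1 * q1 = q1" "q' * q' = q'"
      using projection_absorb_commute p1 q1 ptp qtq proj by (auto simp: is_projection_def)
    have p1pt: "p1 * pt = p1" and q1qt: "q1 * qt = q1" using pp qq by (metis mult.assoc)+
    have qtq1: "qt * q1 = q1" using qtq q1(3) by (metis mult.assoc)
    have "(p - p1) + p1 \<sim>\<^sub>A (q' - q1) + (qt - q')"
      by (rule proj_equiv_add[OF 3 1])
        (simp_all add: left_diff_distrib right_diff_distrib pp qq p1 q1 q1qt)
    then have "p \<sim>\<^sub>A qt - q1" by simp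
    then have "p + (pt - p) \<sim>\<^sub>A (qt - q1) + q1"
      by (rule proj_equiv_add[OF _ 2])
        (simp_all add: left_diff_distrib right_diff_distrib pp qq qtq1)
    then show ?thesis by simp
  qed
  moreover have "pt - p \<preceq>\<^sub>A p'"
    using s projection_le[OF s(1) proj(3) s(3)] proj unfolding proj_subequiv_def
    by (auto simp: proj_equiv_def)
  moreover have "qt - q' \<preceq>\<^sub>A q"
    using t projection_le[OF t(1) proj(2) t(3)] proj unfolding proj_subequiv_def
    by (auto simp: proj_equiv_def)
  ultimately show ?thesis
    using projection_le[OF proj(1,5) ptp] projection_le[OF proj(4,6) qtq] by blast
qed

end
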